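(* Let $s\ge1$ be an integer and $0=c_0<c_1<\cdots<c_s=1$. Let $a_{ij},\widehat a_{ij}$ ($1\le i\le s$, $0\le j\le s$) be the unique real coefficients satisfying, for $i=1,\ldots,s$, the polynomial identity $$\frac{\Pi_i(z)-Q_s(z)}{z}=\sum_{j=0}^s a_{ij}\Pi_j(z)+z\sum_{j=0}^s\widehat a_{ij}\Pi_j(z).$$ Then these coefficients satisfy all the moment conditions $$\sum_{j=0}^s a_{ij}c_j^{m-1}+(m-1)\sum_{j=0}^s\widehat a_{ij}c_j^{m-2}=\frac{c_i^m}{m},\qquad m=1,\ldots,2s,\quad i=1,\ldots,s$$ (for $m=1$ the second sum is understood to be zero).
   Context: $P_s$ and $Q_s$ are the numerator and denominator, normalized by $Q_s(0)=1$, of the Padé approximant $[s-1/s+1]_{e^z}=P_s/Q_s$ of the exponential (i.e. $\deg P_s\le s-1$, $\deg Q_s\le s+1$, $Q_s(z)e^z-P_s(z)=\mathcal O(z^{2s+1})$ as $z\to0$); explicitly $$Q_s(z)=\sum_{k=0}^{s+1}\frac{(2s-k)!\,(s+1)!}{(2s)!\,k!\,(s+1-k)!}(-z)^k.$$ For $j=0,\ldots,s$, $\Pi_j(z)$ is the Taylor truncation at degree $2s$ (terms of degree $\le2s$ retained) of $Q_s(z)e^{c_jz}$. The polynomials $\Pi_0,\ldots,\Pi_s,z\Pi_0,\ldots,z\Pi_s$ form a basis of the space of real polynomials of degree at most $2s+1$, and $(\Pi_i-Q_s)/z$ is a polynomial of degree at most $2s-1$, so the coefficients $a_{ij},\widehat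 a_{ij}$ exist and are unique. The convention $0^0=1$ is used for powers of $c_0=0$. *)

theory Defs
  imports "HOL-Computational_Algebra.Computational_Algebra"
begin

(* The condition Q(z) e^z - P(z) = O(z^(m+n+1)) is read off the formal power series at 0. *)
definition is_pade_exp :: "nat \<Rightarrow> nat \<Rightarrow> real poly \<Rightarrow> real poly \<Rightarrow> bool" where
  "is_pade_exp m n P Q \<longleftrightarrow>
     degree P \<le> m \<and> degree Q \<le> n \<and> poly Q 0 = 1 \<and>
     fps_X ^ (m + n + 1) dvd fps_of_poly Q * fps_exp 1 - fps_of_poly P"

(* Taylor polynomial at 0, terms of degree at most 2s retained, of Q(z) e^(c z);
   truncate_fps n keeps the n coefficients of index less than n. *)
definition Pi_poly :: "nat \<Rightarrow> real poly \<Rightarrow> real \<Rightarrow> real poly" where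
  "Pi_poly s Q c = truncate_fps (2 * s + 1) (fps_of_poly Q * fps_exp c)"


(* The Pade conditions with m = s - 1, n = s + 1 have exactly one solution, whose denominator
   is given by the closed formula below. *)

definition pade_Q :: "nat \<Rightarrow> real poly" where
  "pade_Q s = (\<Sum>k\<le>s + 1. monom ((-1) ^ k * (fact (2 * s - k) * fact (s + 1) /
                 (fact (2 * s) * fact k * fact (s + 1 - k)))) k)"

lemma coeff_pade_Q:
  "coeff (pade_Q s) k = (if k \<le> s + 1 then (-1) ^ k * (fact (2 * s - k) * fact (s + 1) /
                 (fact (2 * s) * fact k * fact (s + 1 - k))) else 0)"
proof -
  have "coeff (pade_Q s) k = (\<Sum>j\<le>s+1. if j = k then (-1) ^ k * (fact (2 * s - k) * fact (s + 1) /
                 (fact (2 * s) * fact k * fact (s + 1 - k))) else 0)"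
    unfolding pade_Q_def coeff_sum coeff_monom by (rule sum.cong) auto
  then show ?thesis by (simp only: sum.delta finite_atMost atMost_iff)
qed

lemma fps_X_power_dvd_iff_nth:
  fixes f :: "real fps"
  shows "fps_X ^ n dvd f \<longleftrightarrow> (\<forall>k<n. fps_nth f k = 0)"
proof
  assume "fps_X ^ n dvd f"
  then obtain g where "f = fps_X ^ n * g" by (elim dvdE)
  then show "\<forall>k<n. fps_nth f k = 0" by (simp add: fps_X_power_mult_nth)
next
  assume a: "\<forall>k<n. fps_nth f k = 0"
  have "f = fps_X ^ n * fps_shift n f"
    by (rule fps_ext) (use a in \<open>auto simp: fps_X_power_mult_nth\<close>)
  then show "fps_X ^ n dvd f" by (rule dvdI)
qed

lemma alternating_sum_Suc:
  fixes f :: "nat \<Rightarrow> real"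
  shows "(\<Sum>k\<le>Suc N. (-1) ^ k * of_nat (Suc N choose k) * f k) =
         (\<Sum>k\<le>N. (-1) ^ k * of_nat (N choose k) * f k) -
         (\<Sum>k\<le>N. (-1) ^ k * of_nat (N choose k) * f (Suc k))"
proof -
  have "(\<Sum>k\<le>N. (-1) ^ k * of_nat (N choose k) * f k) =
        (\<Sum>k\<le>Suc N. (-1) ^ k * of_nat (N choose k) * f k)"
    by (simp add: binomial_eq_0)
  also have "\<dots> = f 0 - (\<Sum>k\<le>N. (-1) ^ k * of_nat (N choose Suc k) * f (Suc k))"
    by (subst sum.atMost_Suc_shift) (simp add: sum_negf)
  finally have 1: "(\<Sum>k\<le>N. (-1) ^ k * of_nat (N choose k) * f k) =
     f 0 - (\<Sum>k\<le>N. (-1) ^ k * of_nat (N choose Suc k) * f (Suc k))" .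
  show ?thesis unfolding 1
    by (subst sum.atMost_Suc_shift) (simp add: sum_negf algebra_simps sum.distrib sum_subtractf)
qed

lemma alternating_binomial_sum:
  "N \<le> M \<Longrightarrow> (\<Sum>k\<le>N. (-1) ^ k * real (N choose k) * real ((M - k) choose r)) =
     (if r < N then 0 else real ((M - N) choose (r - N)))"
proof (induction N arbitrary: M)
  case 0
  then show ?case by simp
next
  case (Suc N)
  then obtain M' where M: "M = Suc M'" "N \<le> M'" by (cases M) auto
  have 1: "Suc M' - N = Suc (M' - N)" using M by auto
  have 2: "r - Suc N = r - N - 1" by simp
  show ?case
    unfolding alternating_sum_Suc
    using Suc.IH[of M] Suc.IH[of M'] M 1 2 
    by (cases "r - N") auto
qed

lemma pade_Q_exp_nth:
  assumes "s \<ge> 1" "s \<le> n" "n \<le> 2 * s"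
  shows "fps_nth (fps_of_poly (pade_Q s) * fps_exp 1) n = 0"
proof -
  define g where "g k = (-1) ^ k * real ((s + 1) choose k) * real ((2 * s - k) choose (2 * s - n))" for k
  have eq: "coeff (pade_Q s) k * (1 / fact (n - k)) = fact (2 * s - n) / fact (2 * s) * g k"
    if "k \<le> n" for k
  proof (cases "k \<le> s + 1")
    case True
    have "2 * s - k - (2 * s - n) = n - k" using that assms by auto
    then show ?thesis using True that assms
      by (simp add: coeff_pade_Q g_def binomial_fact field_simps)
  qed (simp_all add: coeff_pade_Q g_def)
  have "fps_nth (fps_of_poly (pade_Q s) * fps_exp 1) n =
        (\<Sum>k=0..n. coeff (pade_Q s) k * (1 / fact (n - k)))"
    by (simp add: fps_mult_nth)
  also have "\<dots> = fact (2 * s - n) / fact (2 * s) * (\<Sum>k=0..n. g k)"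
    using eq by (simp add: sum_distrib_left)
  also have "(\<Sum>k=0..n. g k) = (\<Sum>k\<le>s+1. g k)"
  proof (rule sum.mono_neutral_cong)
    fix i assume "i \<in> {..s+1} - {0..n}"
    then have "2 * s - i < 2 * s - n" using assms by auto
    then show "g i = 0" by (simp add: g_def)
  qed (auto simp: g_def)
  also have "(\<Sum>k\<le>s+1. g k) = 0"
    unfolding g_def using assms by (subst alternating_binomial_sum) auto
  finally show ?thesis by simp
qed

lemma exp_order_imp_zero:
  fixes r t :: "real poly"
  assumes "fps_X ^ (n + m) dvd fps_of_poly r * fps_exp 1 - fps_of_poly t"
    and "\<And>k. k \<ge> m \<Longrightarrow> coeff t k = 0" and "\<And>k. k \<ge> n \<Longrightarrow> coeff r k = 0"
  shows "r = 0"
  using assms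
proof (induction m arbitrary: r t)
  case 0
  have t: "t = 0" using 0(2) by (intro poly_eqI) auto
  have "fps_X ^ n dvd fps_of_poly r * fps_exp 1 * fps_exp (- 1)"
    using 0(1) t by (intro dvd_mult2[of _ "fps_of_poly r * fps_exp 1"]) simp
  moreover have "fps_exp 1 * fps_exp (- 1) = (1 :: real fps)"
    using fps_exp_add_mult[of "1::real" "- 1"] by simp
  ultimately have "fps_X ^ n dvd fps_of_poly r"
    by (metis mult.assoc mult.right_neutral)
  then show ?case
    using 0(3) by (intro poly_eqI) (metis fps_X_power_dvd_iff_nth fps_of_poly_nth coeff_0 not_le)
next
  case (Suc m)
  let ?F = "fps_of_poly r * fps_exp 1 - fps_of_poly t"
  have F: "fps_deriv ?F = fps_of_poly (r + pderiv r) * fps_exp 1 - fps_of_poly (pderiv t)"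
    by (simp add: fps_of_poly_add fps_of_poly_pderiv algebra_simps)
  have "fps_X ^ (n + m) dvd fps_deriv ?F"
    using Suc.prems(1) unfolding fps_X_power_dvd_iff_nth by (simp del: fps_deriv_sub)
  then have r: "r + pderiv r = 0"
    unfolding F
    by (rule Suc.IH) (use Suc.prems in \<open>auto simp: coeff_pderiv\<close>)
  show "r = 0"
  proof (rule ccontr)
    assume "r \<noteq> 0"
    moreover have "coeff (r + pderiv r) (degree r) = lead_coeff r"
      by (simp add: coeff_pderiv coeff_eq_0)
    ultimately show False using r by simp
  qed
qed

lemma is_pade_exp_unique:
  assumes "s \<ge> 1" "is_pade_exp (s - 1) (s + 1) P Q" "is_pade_exp (s - 1) (s + 1) P' Q'"
  shows "P = P'" "Q = Q'"
proof -
  have s: "s - 1 + (s + 1) + 1 = 2 * s + 1" using assms(1) by auto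
  note a = assms(2,3)[unfolded is_pade_exp_def s fps_X_power_dvd_iff_nth]
  define r where "r = poly_shift 1 (Q - Q')"
  define t where "t = poly_shift 1 (P - P')"
  have q0: "coeff (Q - Q') 0 = 0" using a by (simp add: poly_0_coeff_0)
  have p0: "coeff (P - P') 0 = 0" using a by (auto simp: poly_0_coeff_0 dest!: spec[of _ 0])
  have Q: "fps_of_poly (Q - Q') = fps_X * fps_of_poly r"
    by (rule fps_ext) (use q0 in \<open>auto simp: r_def coeff_poly_shift\<close>)
  have P: "fps_of_poly (P - P') = fps_X * fps_of_poly t"
    by (rule fps_ext) (use p0 in \<open>auto simp: t_def coeff_poly_shift\<close>)
  define G where "G = fps_of_poly r * fps_exp 1 - fps_of_poly t"
  have "fps_X * G = fps_of_poly (Q - Q') * fps_exp 1 - fps_of_poly (P - P')"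
    unfolding Q P G_def by (simp add: algebra_simps)
  also have "\<dots> = (fps_of_poly Q * fps_exp 1 - fps_of_poly P) - (fps_of_poly Q' * fps_exp 1 - fps_of_poly P')"
    by (simp add: fps_of_poly_diff algebra_simps)
  finally have G: "fps_nth (fps_X * G) k = 0" if "k < 2 * s + 1" for k
    using a that by (simp only: fps_sub_nth)
  have "fps_X ^ (2 * s) dvd G"
    unfolding fps_X_power_dvd_iff_nth
  proof (intro allI impI)
    fix k assume "k < 2 * s"
    then show "fps_nth G k = 0" using G[of "Suc k"] by simp
  qed
  then have "fps_X ^ ((s + 1) + (s - 1)) dvd fps_of_poly r * fps_exp 1 - fps_of_poly t"
    using assms(1) by (simp add: G_def mult_2)
  then have "r = 0"
  proof (rule exp_order_imp_zero)
    show "coeff t k = 0" if "k \<ge> s - 1" for k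
      using that a by (simp add: t_def coeff_poly_shift coeff_eq_0)
    show "coeff r k = 0" if "k \<ge> s + 1" for k
      using that a by (simp add: r_def coeff_poly_shift coeff_eq_0)
  qed
  then have "fps_of_poly (Q - Q') = fps_of_poly 0" using Q by simp
  then show QQ: "Q = Q'" by (simp only: fps_of_poly_eq_iff right_minus_eq)
  show "P = P'"
  proof (rule poly_eqI)
    fix k
    show "coeff P k = coeff P' k"
    proof (cases "k < 2 * s + 1")
      case True
      then show ?thesis using a QQ by (metis fps_of_poly_nth fps_sub_nth eq_iff_diff_eq_0)
    next
      case False
      then have "degree P < k" "degree P' < k" using a by linarith+
      then show ?thesis by (simp add: coeff_eq_0)
    qed
  qed
qed

theorem is_pade_exp_iff:
  assumes "s \<ge> 1"
  shows "is_pade_exp (s - 1) (s + 1) P Q \<longleftrightarrow>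
           Q = pade_Q s \<and> P = truncate_fps s (fps_of_poly (pade_Q s) * fps_exp 1)"
proof -
  have s: "s - 1 + (s + 1) + 1 = 2 * s + 1" using assms by auto
  let ?P = "truncate_fps s (fps_of_poly (pade_Q s) * fps_exp 1)"
  have "is_pade_exp (s - 1) (s + 1) ?P (pade_Q s)"
    unfolding is_pade_exp_def s fps_X_power_dvd_iff_nth
  proof (intro conjI allI impI)
    show "degree ?P \<le> s - 1"
      using degree_truncate_fps[of s] assms by (metis Suc_pred' less_Suc_eq_le less_le_trans zero_less_one)
    show "degree (pade_Q s) \<le> s + 1"
      by (rule degree_le) (simp add: coeff_pade_Q)
    show "poly (pade_Q s) 0 = 1"
      by (simp add: poly_0_coeff_0 coeff_pade_Q)
    fix k assume "k < 2 * s + 1"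
    then show "fps_nth (fps_of_poly (pade_Q s) * fps_exp 1 - fps_of_poly ?P) k = 0"
      using pade_Q_exp_nth[of s k] assms by (cases "k < s") auto
  qed
  then show ?thesis using is_pade_exp_unique[OF assms] by blast
qed

end

(* Multiply the polynomial identity by z and replace every Pi_j by Q e^(c_j z); this is exact up to
   order z^(2s).  As Q(0) = 1, the factor Q is invertible as a power series and cancels, which leaves
     e^(c_i z) - 1 = z (\<Sum>j. a_ij e^(c_j z)) + z^2 (\<Sum>j. ahat_ij e^(c_j z)) + O(z^(2s+1)).
   The coefficient of z^m, multiplied by (m-1)!, is the m-th moment condition. *)
theory Submission
  imports Defs
begin

text \<open>Euclidean division by z drops the constant term and shifts the other coefficients down
  by one.\<close>

lemma coeff_div_X:
  fixes p :: "'a :: field poly"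
  shows "coeff (p div [:0, 1:]) k = coeff p (Suc k)"
proof (cases p)
  case (pCons b q)
  have "p = [:b:] + q * [:0, 1:]" by (simp add: pCons)
  also have "\<dots> div [:0, 1:] = q" by (subst div_mult_self1) (simp_all add: div_poly_less)
  finally show ?thesis by (simp add: pCons)
qed

lemma coeff_Pi_poly:
  "k \<le> 2 * s \<Longrightarrow> coeff (Pi_poly s Q x) k = fps_nth (fps_of_poly Q * fps_exp x) k"
  by (simp add: Pi_poly_def)

text \<open>A power series with nonzero constant term is a unit, so it does not affect divisibility
  by a power of z.\<close>

lemma fps_X_power_dvd_cancel_left:
  fixes f g :: "'a :: field fps"
  assumes "fps_nth f 0 \<noteq> 0" "fps_X ^ n dvd f * g"
  shows "fps_X ^ n dvd g"
  using assms by (simp add: dvd_mult_unit_iff')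

theorem theorem5p3:
  fixes s :: nat
    and c :: "nat \<Rightarrow> real"
    and P Q :: "real poly"
    and a ahat :: "nat \<Rightarrow> nat \<Rightarrow> real"
  assumes "s \<ge> 1"
    and "c 0 = 0" and "c s = 1" and "strict_mono_on {0..s} c"
    and "is_pade_exp (s - 1) (s + 1) P Q"
    and "\<forall>i\<in>{1..s}. (Pi_poly s Q (c i) - Q) div [:0, 1:] =
           (\<Sum>j=0..s. smult (a i j) (Pi_poly s Q (c j))) +
           [:0, 1:] * (\<Sum>j=0..s. smult (ahat i j) (Pi_poly s Q (c j)))"
  shows "\<forall>i\<in>{1..s}. \<forall>m\<in>{1..2 * s}.
           (\<Sum>j=0..s. a i j * c j ^ (m - 1)) +
           real (m - 1) * (\<Sum>j=0..s. ahat i j * c j ^ (m - 2)) = c i ^ m / real m"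
proof (intro ballI)
  fix i m assume i: "i \<in> {1..s}" and m: "m \<in> {1..2 * s}"
  define q where "q = fps_of_poly Q"
  define A where "A = (\<Sum>j=0..s. fps_const (a i j) * fps_exp (c j))"
  define B where "B = (\<Sum>j=0..s. fps_const (ahat i j) * fps_exp (c j))"
  \<comment> \<open>\<open>D\<close> is the defect of the identity once the factor \<open>q\<close>
    is cancelled; the moment conditions say that its coefficients 1 to 2s vanish.\<close>
  define D where "D = fps_exp (c i) - 1 - fps_X * (A + fps_X * B)"
  have q0: "fps_nth q 0 \<noteq> 0"
    using assms(5) by (simp add: q_def is_pade_exp_def poly_0_coeff_0)
  have qA: "q * A = (\<Sum>j=0..s. fps_const (a i j) * (q * fps_exp (c j)))"
    by (simp add: A_def sum_distrib_left mult.left_commute)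
  have qB: "q * B = (\<Sum>j=0..s. fps_const (ahat i j) * (q * fps_exp (c j)))"
    by (simp add: B_def sum_distrib_left mult.left_commute)
  have "q * D = q * fps_exp (c i) - q - fps_X * (q * A + fps_X * (q * B))"
    by (simp add: D_def algebra_simps)
  moreover have "fps_nth (q * fps_exp (c i) - q - fps_X * (q * A + fps_X * (q * B))) k = 0"
    if k: "k < 2 * s + 1" for k
  proof (cases k)
    case 0
    then show ?thesis by simp
  next
    case (Suc n)
    \<comment> \<open>Coefficient n of the given identity is coefficient n + 1 of its multiple by z.
      Since n + 1 \<le> 2s, every coefficient of a \<open>Pi_poly\<close> involved lies below the
      truncation and equals that of the full series.\<close>
    have "coeff ((Pi_poly s Q (c i) - Q) div [:0, 1:]) n =
           coeff ((\<Sum>j=0..s. smult (a i j) (Pi_poly s Q (c j))) +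
           [:0, 1:] * (\<Sum>j=0..s. smult (ahat i j) (Pi_poly s Q (c j)))) n"
      using assms(6) i by simp
    then show ?thesis
      using k Suc unfolding coeff_div_X qA qB
      by (cases n) (simp_all add: coeff_Pi_poly coeff_sum fps_sum_nth flip: q_def, simp_all add: q_def)
  qed
  ultimately have "fps_X ^ (2 * s + 1) dvd q * D"
    by (simp only: fps_X_power_dvd_iff_nth) blast
  with q0 have "fps_X ^ (2 * s + 1) dvd D"
    by (rule fps_X_power_dvd_cancel_left)
  then have Dm: "fps_nth D m = 0"
    using m unfolding fps_X_power_dvd_iff_nth by simp
  obtain n where n: "m = Suc n" using m by (cases m) auto
  \<comment> \<open>This is coefficient m = n + 1 of \<open>D\<close>. The z^2 term contributes 1 /
    (n - 1)! = n / n!; for n = 0 it is absent, which the factor n reproduces.\<close>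
  have "c i ^ m / fact m =
      (\<Sum>j=0..s. a i j * c j ^ n / fact n) + real n * (\<Sum>j=0..s. ahat i j * c j ^ (n - 1) / fact n)"
  proof (cases n)
    case 0
    then show ?thesis using Dm n by (simp add: D_def A_def fps_sum_nth)
  next
    case (Suc l)
    have "real n * (x / fact n) = x / fact l" for x :: real
      using Suc by (simp del: of_nat_Suc)
    then show ?thesis
      using Dm n Suc by (simp add: D_def A_def B_def fps_sum_nth sum_distrib_left del: fact_Suc of_nat_Suc)
  qed
  also have "\<dots> = ((\<Sum>j=0..s. a i j * c j ^ n) + real n * (\<Sum>j=0..s. ahat i j * c j ^ (n - 1))) / fact n"
    by (simp add: sum_divide_distrib add_divide_distrib flip: times_divide_eq_right)
  finally have "(\<Sum>j=0..s. a i j * c j ^ n) + real n * (\<Sum>j=0..s. ahat i j * c j ^ (n - 1)) =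
      c i ^ m / fact m * fact n"
    by (simp add: field_simps)
  also have "\<dots> = c i ^ m / real m"
    using n by (simp del: of_nat_Suc)
  finally show "(\<Sum>j=0..s. a i j * c j ^ (m - 1)) +
      real (m - 1) * (\<Sum>j=0..s. ahat i j * c j ^ (m - 2)) = c i ^ m / real m"
    \<comment> \<open>With truncated subtraction, m - 2 = n - 1 also when m = 1.\<close>
    by (simp add: n numeral_2_eq_2)
qed

end
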